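(* Let $h_1,\dots,h_6$ be generic complex numbers with $h_1+\cdots+h_6=0$. For every $6$-dimensional partition $\Delta$, let $$\psi_\Delta(u)=\frac1u\prod_{\vec\square\in\Delta}\varphi_1\bigl(u-c(\vec\square)\bigr)\prod_{\phi_4\subseteq\Delta}\varphi_4\bigl(u-c(\phi_4)\bigr)\prod_{\phi_6\subseteq\Delta}\varphi_6\bigl(u-c(\phi_6)\bigr)\prod_{\phi_7\subseteq\Delta}\varphi_7\bigl(u-c(\phi_7)\bigr),$$ where $$\varphi_1(u)=\frac{\prod_{i=1}^{6}(u+h_i)}{\prod_{i=1}^{6}(u-h_i)}\prod_{1\le a_1<a_2\le 6}(u-h_{a_1}-h_{a_2})\prod_{1\le a_1<a_2<a_3<a_4\le 6}(u-h_{a_1}-h_{a_2}-h_{a_3}-h_{a_4}),$$ $$\varphi_4(u)=\frac1u,\qquad \varphi_6(u)=\frac1{u^2},\qquad \varphi_7(u)=u^2 .$$ Then for every $6$-dimensional partition $\Delta$: 1. the rational function $\psi_\Delta(u)$ has only simple poles; 2. for every $\vec\square\in\mathbb Z_{\ge0}^6$, the function $\psi_\Delta(u)$ has a pole of order $1$ at $u=c(\vec\square)$ if and only if there exists $\tilde{\vec\square}\in \mathrm A_\Delta\cup \mathrm R_\Delta$ with $c(\tilde{\vec\square})=c(\vec\square)$. In particular, the set of poles of $\psi_\Delta$ is exactly $\{c(\tilde{\vec\square}) : \tilde{\vec\square}\in \mathrm A_\Delta\cup \mathrm R_\Delta\}$.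
   Context: Let $\vec e_1,\dots,\vec e_6$ be the standard basis of $\mathbb Z^6$. Elements of $\mathbb Z_{\ge0}^6$ are called boxes. A $6$-dimensional partition is a finite (possibly empty) subset $\Delta\subset\mathbb Z_{\ge0}^6$ such that for every box $\vec\square\in\mathbb Z_{\ge 0}^6$ and every $k\in\{1,\dots,6\}$, if $\vec\square+\vec e_k\in\Delta$ then $\vec\square\in\Delta$. $\mathrm A_\Delta$ is the set of addable boxes: those $\vec\square\in\mathbb Z_{\ge0}^6\setminus\Delta$ such that $\Delta\cup\{\vec\square\}$ is a partition. $\mathrm R_\Delta$ is the set of removable boxes: those $\vec\square\in\Delta$ such that $\Delta\setminus\{\vec\square\}$ is a partition. The projection map is $c\bigl(\sum_{i=1}^6 l_i\vec e_i\bigr)=\sum_{i=1}^6 l_ih_i\in\mathbb C$. "Generic" means that the only integer linear relations among the $h_i$ are the multiples of $\sum_i h_i=0$, i.e. if $m_1,\dots,m_6\in\mathbb Z$ and $\sum_i m_ih_i=0$, then $m_1=\cdots=m_6$. Clusters: for a box $\vec\square$ and a subset $S\subseteq\{1,\dots,6\}$ with $|S|=p-1$, the $p$-box cluster is $\phi_p(\vec\square;S)=\{\vec\square\}\cup\{\vec\square+\vec e_s: s\in S\}$, and its projected coordinate is $c(\phi_p(\vec\square;S))=c(\vec\square)+\sum_{s\in S}h_s$. The product $\prod_{\phi_p\subseteq\Delta}$ runs over all pairs $(\vec\square,S)$ with $|S|=p-1$ and $\phi_p(\vec\square;S)\subseteq\Delta$. Empty products equal $1$. Pole orders refer to $\psi_\Delta$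 as a rational function after all cancellations. *)

theory Defs
  imports "HOL-Complex_Analysis.Complex_Analysis" "HOL-Library.Numeral_Type"
begin

(* The six coordinate directions are the elements of the type 6; axis k 1 is e_k. *)
type_synonym box = "nat ^ 6"

definition is_partition :: "box set \<Rightarrow> bool" where
  "is_partition \<Delta> \<longleftrightarrow> finite \<Delta> \<and> (\<forall>b k. b + axis k 1 \<in> \<Delta> \<longrightarrow> b \<in> \<Delta>)"

definition addable :: "box set \<Rightarrow> box set" where
  "addable \<Delta> = {b. b \<notin> \<Delta> \<and> is_partition (insert b \<Delta>)}"

definition removable :: "box set \<Rightarrow> box set" where
  "removable \<Delta> = {b. b \<in> \<Delta> \<and> is_partition (\<Delta> - {b})}"

definition generic :: "complex ^ 6 \<Rightarrow> bool" where
  "generic h \<longleftrightarrow>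
     (\<forall>m :: int ^ 6. (\<Sum>i\<in>UNIV. of_int (m $ i) * h $ i) = 0 \<longrightarrow> (\<forall>i j. m $ i = m $ j))"

definition proj :: "complex ^ 6 \<Rightarrow> box \<Rightarrow> complex" where
  "proj h b = (\<Sum>i\<in>UNIV. of_nat (b $ i) * h $ i)"

definition cluster :: "box \<Rightarrow> 6 set \<Rightarrow> box set" where
  "cluster b S = insert b ((\<lambda>s. b + axis s 1) ` S)"

definition clusters_in :: "nat \<Rightarrow> box set \<Rightarrow> (box \<times> 6 set) set" where
  "clusters_in p \<Delta> = {(b, S). card S = p - 1 \<and> cluster b S \<subseteq> \<Delta>}"

definition proj_cluster :: "complex ^ 6 \<Rightarrow> box \<times> 6 set \<Rightarrow> complex" where
  "proj_cluster h = (\<lambda>(b, S). proj h b + (\<Sum>s\<in>S. h $ s))"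

(* Products over a_1 < ... < a_k are products over the k-element sets of directions. *)
definition phi1 :: "complex ^ 6 \<Rightarrow> complex \<Rightarrow> complex" where
  "phi1 h u =
     (\<Prod>i\<in>UNIV. u + h $ i) / (\<Prod>i\<in>UNIV. u - h $ i)
     * (\<Prod>A | card A = 2. u - (\<Sum>a\<in>A. h $ a))
     * (\<Prod>A | card A = 4. u - (\<Sum>a\<in>A. h $ a))"

definition phi4 :: "complex \<Rightarrow> complex" where
  "phi4 u = 1 / u"

definition phi6 :: "complex \<Rightarrow> complex" where
  "phi6 u = 1 / u ^ 2"

definition phi7 :: "complex \<Rightarrow> complex" where
  "phi7 u = u ^ 2"

(* At the finitely many zeros of the denominators the value is an artefact of x / 0 = 0.
   Poles and their orders (is_pole, zorder) depend only on punctured neighbourhoods, so they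
   are those of the rational function after cancellation. *)
definition psi :: "complex ^ 6 \<Rightarrow> box set \<Rightarrow> complex \<Rightarrow> complex" where
  "psi h \<Delta> u =
     1 / u
     * (\<Prod>b\<in>\<Delta>. phi1 h (u - proj h b))
     * (\<Prod>\<phi>\<in>clusters_in 4 \<Delta>. phi4 (u - proj_cluster h \<phi>))
     * (\<Prod>\<phi>\<in>clusters_in 6 \<Delta>. phi6 (u - proj_cluster h \<phi>))
     * (\<Prod>\<phi>\<in>clusters_in 7 \<Delta>. phi7 (u - proj_cluster h \<phi>))"

(* zorder counts a pole of order n as -n. *)
definition has_simple_pole :: "(complex \<Rightarrow> complex) \<Rightarrow> complex \<Rightarrow> bool" where
  "has_simple_pole f z \<longleftrightarrow> is_pole f z \<and> zorder f z = -1"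

end

theory Submission
  imports Defs
begin

text \<open>Every zero and pole of every factor of \<open>\<psi>\<close> is the projection of a lattice point \<open>b + e\<^sub>S\<close> with \<open>b \<in> \<Delta>\<close>
  and \<open>S\<close> a set of directions, so the order of \<open>\<psi>\<close> at a point \<open>z\<close> is a sum of local contributions of the
  lattice points \<open>v\<close> over \<open>z\<close>. The contribution of \<open>v\<close> depends only on the family \<open>D\<close> of the sets \<open>S\<close> with
  \<open>v - e\<^sub>S \<in> \<Delta>\<close>, an up-closed family of subsets of the support of \<open>v\<close>. By genericity the fibre over \<open>z\<close> is a
  line \<open>y, y + (1,\<dots>,1), y + 2(1,\<dots>,1), \<dots>\<close> whose first point \<open>y\<close> has a zero coordinate, and all points
  contribute \<open>0\<close> except \<open>y\<close> and the first point \<open>t\<close> of the line outside \<open>\<Delta>\<close>. If \<open>y \<in> \<Delta>\<close>, then \<open>y\<close>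
  (with the factor \<open>1/u\<close>) contributes \<open>-1\<close>, and \<open>t\<close> contributes \<open>0\<close> if \<open>t\<close> is addable or \<open>t - (1,\<dots>,1)\<close> is
  removable, and a positive amount otherwise. If \<open>y \<notin> \<Delta>\<close>, the order is \<open>-1\<close> if \<open>y\<close> is addable and
  nonnegative otherwise. These inequalities bound edges against triangles in the graph of the
  two-element members of \<open>D\<close>, whose singletons are dominating vertices.\<close>

section \<open>Orders at a point\<close>

text \<open>The normal form is required only on a punctured neighbourhood, so the default values at
  zeros of denominators never matter and orders simply add under products.\<close>

definition has_order :: "(complex \<Rightarrow> complex) \<Rightarrow> complex \<Rightarrow> int \<Rightarrow> bool" where
  "has_order f z n \<longleftrightarrow>
     (\<exists>g. g analytic_on {z} \<and> g z \<noteq> 0 \<and> (\<forall>\<^sub>F u in at z. f u = g u * (u - z) powi n))"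

lemma has_order_const: "c \<noteq> 0 \<Longrightarrow> has_order (\<lambda>_. c) z 0"
  unfolding has_order_def by (rule exI[of _ "\<lambda>_. c"]) auto

lemma has_order_linear: "has_order (\<lambda>u. u - c) z (of_bool (z = c))"
proof (cases "z = c")
  case True
  then show ?thesis
    unfolding has_order_def by (intro exI[of _ "\<lambda>_. 1"]) auto
next
  case False
  then show ?thesis
    unfolding has_order_def by (intro exI[of _ "\<lambda>u. u - c"]) (auto intro!: analytic_intros)
qed

lemma has_order_mult:
  assumes "has_order f z m" "has_order g z n"
  shows "has_order (\<lambda>u. f u * g u) z (m + n)"
proof -
  obtain F where F: "F analytic_on {z}" "F z \<noteq> 0" "\<forall>\<^sub>F u in at z. f u = F u * (u - z) powi m"
    using assms(1) unfolding has_order_def by blast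
  obtain G where G: "G analytic_on {z}" "G z \<noteq> 0" "\<forall>\<^sub>F u in at z. g u = G u * (u - z) powi n"
    using assms(2) unfolding has_order_def by blast
  have "\<forall>\<^sub>F u in at z. f u * g u = (F u * G u) * (u - z) powi (m + n)"
    using F(3) G(3) eventually_neq_at_within[of z z UNIV]
    by eventually_elim (simp add: power_int_add)
  then show ?thesis
    unfolding has_order_def using F G
    by (intro exI[of _ "\<lambda>u. F u * G u"]) (auto intro!: analytic_intros)
qed

lemma has_order_inverse:
  assumes "has_order f z n"
  shows "has_order (\<lambda>u. inverse (f u)) z (- n)"
proof -
  obtain F where F: "F analytic_on {z}" "F z \<noteq> 0" "\<forall>\<^sub>F u in at z. f u = F u * (u - z) powi n"
    using assms unfolding has_order_def by blast
  have "\<forall>\<^sub>F u in at z. inverse (f u) = inverse (F u) * (u - z) powi (- n)"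
    using F(3) by eventually_elim (simp add: power_int_minus)
  then show ?thesis
    unfolding has_order_def using F
    by (intro exI[of _ "\<lambda>u. inverse (F u)"]) (auto intro!: analytic_intros)
qed

lemma has_order_divide:
  assumes "has_order f z m" "has_order g z n"
  shows "has_order (\<lambda>u. f u / g u) z (m - n)"
  using has_order_mult[OF assms(1) has_order_inverse[OF assms(2)]]
  by (simp add: divide_inverse)

lemma has_order_power2:
  assumes "has_order f z n"
  shows "has_order (\<lambda>u. (f u)\<^sup>2) z (2 * n)"
  unfolding power2_eq_square mult_2 by (rule has_order_mult[OF assms assms])

lemma has_order_prod:
  assumes "\<And>i. i \<in> I \<Longrightarrow> has_order (f i) z (n i)"
  shows "has_order (\<lambda>u. \<Prod>i\<in>I. f i u) z (\<Sum>i\<in>I. n i)"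
proof (cases "finite I")
  case True
  then show ?thesis
    using assms by (induction I) (auto intro: has_order_mult has_order_const)
\<comment> \<open>Over an infinite index set the product is 1 and the sum is 0, so order 0 is
  correct.\<close>
qed (simp add: has_order_const)

lemma has_order_zorder:
  assumes "has_order f z n"
  shows "zorder f z = n"
proof -
  obtain g where g: "g analytic_on {z}" "g z \<noteq> 0" "\<forall>\<^sub>F u in at z. f u = g u * (u - z) powi n"
    using assms unfolding has_order_def by blast
  obtain S where S: "open S" "z \<in> S" "g holomorphic_on S"
    using g(1) analytic_at by blast
  obtain T where T: "open T" "z \<in> T" "\<And>u. u \<in> T \<Longrightarrow> u \<noteq> z \<Longrightarrow> f u = g u * (u - z) powi n"
    using g(3) unfolding eventually_at_topological by blast
  show ?thesis
    by (rule zorder_eqI[of "S \<inter> T" z g]) (use S T g in \<open>auto intro: holomorphic_on_subset\<close>)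
qed

text \<open>Complements \<open>has_order_zorder\<close>: \<open>has_simple_pole\<close> asks for a
  genuine pole as well as for the value of \<open>zorder\<close>.\<close>

lemma has_order_is_pole:
  assumes "has_order f z n"
  shows "is_pole f z \<longleftrightarrow> n < 0"
proof -
  obtain g where g: "g analytic_on {z}" "g z \<noteq> 0" "\<forall>\<^sub>F u in at z. f u = g u * (u - z) powi n"
    using assms unfolding has_order_def by blast
  have cont: "isCont g z"
    using g(1) analytic_at_imp_isCont by blast
  have eq: "is_pole f z \<longleftrightarrow> is_pole (\<lambda>u. g u * (u - z) powi n) z"
    by (rule is_pole_cong[OF g(3) refl])
  show ?thesis
  proof (cases "n < 0")
    case True
    define k where "k = nat (- n)"
    have k: "k > 0" "n = - int k"
      using True by (auto simp: k_def)
    have "filterlim (\<lambda>u. (u - z) ^ k) (at 0) (at z)"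
      unfolding filterlim_at using k(1)
      by (auto intro!: tendsto_eq_intros simp: eventually_at_filter)
    then have "is_pole (\<lambda>u. g u / (u - z) ^ k) z"
      using cont g(2) by (intro is_pole_divide)
    then show ?thesis
      using eq True k(2) by (simp add: power_int_minus divide_inverse)
  next
    case False
    then have "n = int (nat n)"
      by simp
    moreover have "((\<lambda>u. g u * (u - z) ^ nat n) \<longlongrightarrow> g z * (z - z) ^ nat n) (at z)"
      using cont by (intro tendsto_intros) (simp add: isCont_def)
    ultimately have "((\<lambda>u. g u * (u - z) powi n) \<longlongrightarrow> g z * (z - z) ^ nat n) (at z)"
      by (metis (no_types, lifting) ext power_int_of_nat)
    then have "\<not> is_pole (\<lambda>u. g u * (u - z) powi n) z"
      unfolding is_pole_def using not_tendsto_and_filterlim_at_infinity[of "at z"] by auto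
    then show ?thesis
      using eq False by simp
  qed
qed

section \<open>Orders of the factors as sums of indicators\<close>

lemma has_order_phi1:
  "has_order (\<lambda>u. phi1 h (u - p)) z
     ((\<Sum>i\<in>UNIV. of_bool (z = p - h $ i)) - (\<Sum>i\<in>UNIV. of_bool (z = p + h $ i))
      + (\<Sum>A | card A = 2. of_bool (z = p + (\<Sum>a\<in>A. h $ a)))
      + (\<Sum>A | card A = 4. of_bool (z = p + (\<Sum>a\<in>A. h $ a))))"
proof -
  \<comment> \<open>Every factor is brought to the form \<open>u - c\<close> so that
    \<open>has_order_linear\<close> matches.\<close>
  have 1: "u - p + c = u - (p - c)" "u - p - c = u - (p + c)" for u c :: complex
    by simp_all
  show ?thesis
    unfolding phi1_def 1
    by (intro has_order_mult has_order_divide has_order_prod has_order_linear)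
qed

lemma has_order_psi:
  "has_order (psi h \<Delta>) z
     (- of_bool (z = 0)
      + (\<Sum>b\<in>\<Delta>. (\<Sum>i\<in>UNIV. of_bool (z = proj h b - h $ i)) - (\<Sum>i\<in>UNIV. of_bool (z = proj h b + h $ i))
           + (\<Sum>A | card A = 2. of_bool (z = proj h b + (\<Sum>a\<in>A. h $ a)))
           + (\<Sum>A | card A = 4. of_bool (z = proj h b + (\<Sum>a\<in>A. h $ a))))
      + (\<Sum>\<phi>\<in>clusters_in 4 \<Delta>. - of_bool (z = proj_cluster h \<phi>))
      + (\<Sum>\<phi>\<in>clusters_in 6 \<Delta>. - (2 * of_bool (z = proj_cluster h \<phi>)))
      + (\<Sum>\<phi>\<in>clusters_in 7 \<Delta>. 2 * of_bool (z = proj_cluster h \<phi>)))"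
proof -
  have inv: "has_order (\<lambda>u. 1 / (u - c)) z (- of_bool (z = c))" for c
    using has_order_inverse[OF has_order_linear[of c z]] by (simp add: divide_inverse)
  have inv2: "has_order (\<lambda>u. 1 / (u - c)\<^sup>2) z (- (2 * of_bool (z = c)))" for c
    using has_order_inverse[OF has_order_power2[OF has_order_linear[of c z]]]
    by (simp add: divide_inverse)
  have inv0: "has_order (\<lambda>u. 1 / u) z (- of_bool (z = 0))"
    using inv[of 0] by simp
  show ?thesis
    unfolding psi_def phi4_def phi6_def phi7_def
    by (intro has_order_mult has_order_prod has_order_phi1 inv inv0 inv2 has_order_power2
        has_order_linear)
qed

section \<open>Up-closed families of subsets of a set with at most six elements\<close>

definition level :: "'a set set \<Rightarrow> nat \<Rightarrow> 'a set set" where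
  "level D k = {S \<in> D. card S = k}"

definition full_level :: "'a set set \<Rightarrow> nat \<Rightarrow> 'a set set" where
  "full_level D k = {S \<in> D. card S = k \<and> (\<forall>s\<in>S. S - {s} \<in> D)}"

text \<open>For \<open>D\<close> the family of sets \<open>S\<close> with \<open>v - e\<^sub>S \<in> \<Delta>\<close>, this is the order that the boxes and clusters
  lying over the single lattice point \<open>v\<close> contribute at the projection of \<open>v\<close>: modulo \<open>\<Sum>h = 0\<close> each
  linear factor of \<open>\<phi>\<^sub>1\<close> vanishes at some \<open>h\<^sub>S\<close>, where the numerator factor \<open>u + h\<^sub>i\<close> belongs to the
  five-element complement of \<open>i\<close>, and a cluster \<open>(v - e\<^sub>S, S)\<close> lies in \<open>\<Delta>\<close> iff \<open>S\<close> and all \<open>S - {s}\<close>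
  are in \<open>D\<close>.\<close>

definition local_order :: "'a set set \<Rightarrow> int" where
  "local_order D =
     - int (card (level D 1)) + int (card (level D 2)) + int (card (level D 4)) + int (card (level D 5))
     - int (card (full_level D 3)) - 2 * int (card (full_level D 5)) + 2 * int (card (full_level D 6))"

text \<open>A pair inside \<open>M\<close> either meets \<open>K\<close>, and then belongs to
  \<open>E\<close>, or lies in \<open>M - K\<close>.\<close>

lemma pairs_ge_dominating:
  assumes "finite M" "E \<subseteq> Pow M" "\<And>P. P \<in> E \<Longrightarrow> card P = 2" "K \<subseteq> M"
    and dom: "\<And>a b. a \<in> K \<Longrightarrow> b \<in> M \<Longrightarrow> a \<noteq> b \<Longrightarrow> {a, b} \<in> E"
  shows "card M choose 2 \<le> card E + (card M - card K choose 2)"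
proof -
  let ?P = "\<lambda>X. {P. P \<subseteq> X \<and> card P = 2}"
  have fin: "finite K" "finite E"
    using assms by (auto intro: finite_subset)
  have "?P M \<subseteq> E \<union> ?P (M - K)"
    using dom by (auto simp: card_2_iff) (metis insert_commute)+
  then have "card (?P M) \<le> card (E \<union> ?P (M - K))"
    using fin assms(1) by (intro card_mono) auto
  also have "\<dots> \<le> card E + card (?P (M - K))"
    by (rule card_Un_le)
  finally show ?thesis
    using assms(1,4) fin by (simp add: n_subsets card_Diff_subset)
qed

text \<open>Double counting of incidences: a full triple contains exactly three pairs of
  \<open>D\<close>, and a pair extends to a triple inside \<open>M\<close> in at most
  \<open>card M - 2\<close> ways.\<close>

lemma triple_full_count:
  assumes fin: "finite M" and D: "D \<subseteq> Pow M"
  shows "3 * card (full_level D 3) \<le> (card M - 2) * card (level D 2)"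
proof -
  let ?T = "full_level D 3" and ?E = "level D 2"
  have finT: "finite ?T" and finE: "finite ?E"
    using fin D by (auto simp: full_level_def level_def intro: finite_subset[of _ "Pow M"])
  have three: "card {P \<in> ?E. P \<subseteq> S} = 3" if S: "S \<in> ?T" for S
  proof -
    have cS: "card S = 3" "finite S"
      using S by (auto simp: full_level_def intro: card_ge_0_finite)
    have "P \<in> (\<lambda>s. S - {s}) ` S" if P: "P \<subseteq> S" "card P = 2" for P
    proof -
      have "card (S - P) = 1"
        using P cS by (subst card_Diff_subset) (auto intro: finite_subset)
      then obtain s where s: "S - P = {s}"
        using card_1_singletonE by blast
      then have "P = S - {s}" "s \<in> S"
        using P by auto
      then show ?thesis
        by blast
    qed
    then have "{P \<in> ?E. P \<subseteq> S} = (\<lambda>s. S - {s}) ` S"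
      using S cS by (auto simp: level_def full_level_def)
    moreover have "inj_on (\<lambda>s. S - {s}) S"
      by (auto simp: inj_on_def)
    ultimately show ?thesis
      using cS by (simp add: card_image)
  qed
  have bound: "card {S \<in> ?T. P \<subseteq> S} \<le> card M - 2" if P: "P \<in> ?E" for P
  proof -
    have cP: "card P = 2" "P \<subseteq> M" "finite P"
      using P D fin by (auto simp: level_def intro: card_ge_0_finite)
    have "S \<in> (\<lambda>x. insert x P) ` (M - P)" if S: "S \<in> ?T" "P \<subseteq> S" for S
    proof -
      have "card (S - P) = 1"
        using S cP by (subst card_Diff_subset) (auto simp: full_level_def)
      then obtain s where s: "S - P = {s}"
        using card_1_singletonE by blast
      then have "S = insert s P" "s \<in> M - P"
        using S D by (auto simp: full_level_def)
      then show ?thesis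
        by blast
    qed
    then have "card {S \<in> ?T. P \<subseteq> S} \<le> card ((\<lambda>x. insert x P) ` (M - P))"
      using fin by (intro card_mono) auto
    also have "\<dots> \<le> card (M - P)"
      using fin by (intro card_image_le) auto
    finally show ?thesis
      using cP by (simp add: card_Diff_subset)
  qed
  have "3 * card ?T = (\<Sum>S\<in>?T. card {P \<in> ?E. P \<subseteq> S})"
    using three by simp
  also have "\<dots> = (\<Sum>P\<in>?E. card {S \<in> ?T. P \<subseteq> S})"
    by (rule sum_multicount_gen[symmetric]) (use finT finE in auto)
  also have "\<dots> \<le> (\<Sum>P\<in>?E. card M - 2)"
    by (rule sum_mono) (rule bound)
  finally show ?thesis
    by (simp add: mult.commute)
qed

section \<open>Bounds on the local order of an up-closed family\<close>

locale upset =
  fixes M :: "'a set" and D :: "'a set set"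
  assumes fin: "finite M"
    and sub: "D \<subseteq> Pow M"
    and up: "S \<in> D \<Longrightarrow> S \<subseteq> T \<Longrightarrow> T \<subseteq> M \<Longrightarrow> T \<in> D"
begin

lemma finite_D: "finite D"
  using fin sub by (auto intro: finite_subset)

lemma finite_level: "finite (level D k)"
  and finite_full_level: "finite (full_level D k)"
  using finite_D by (simp_all add: level_def full_level_def)

lemma card_le: "S \<in> D \<Longrightarrow> card S \<le> card M"
  using sub card_mono[OF fin, of S] by auto

lemma level_empty: "card M < k \<Longrightarrow> level D k = {}"
  and full_level_empty: "card M < k \<Longrightarrow> full_level D k = {}"
  by (auto simp: level_def full_level_def dest: card_le)

text \<open>Up-closure puts every nonempty subset of \<open>M\<close> into \<open>D\<close>, so with
  \<open>m = card M\<close> the order is \<open>- m + (m choose 2) - (m choose 3) + (m choose 4) -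
  (m choose 5) + 2 * (m choose 6)\<close>. This is an alternating binomial sum without its constant
  term, hence -1 for \<open>m > 0\<close>, except that the doubled last term lifts it to 0 at
  \<open>m = 6\<close>.\<close>

lemma local_order_all_singletons:
  assumes "\<And>a. a \<in> M \<Longrightarrow> {a} \<in> D" "card M \<le> 6"
  shows "local_order D = - of_bool (M \<noteq> {} \<and> card M < 6)"
proof -
  have mem: "S \<in> D" if S: "S \<subseteq> M" "S \<noteq> {}" for S
  proof -
    obtain a where "a \<in> S" using S by blast
    then show ?thesis using assms(1)[of a] up[of "{a}" S] S by auto
  qed
  have lev: "level D k = {S. S \<subseteq> M \<and> card S = k}" if "k > 0" for k
  proof -
    have "S \<noteq> {}" if "card S = k" for S :: "'a set"
      using that \<open>k > 0\<close> by auto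
    then show ?thesis
      using mem sub by (auto simp: level_def)
  qed
  have full: "full_level D k = {S. S \<subseteq> M \<and> card S = k}" if "k > 1" for k
  proof -
    have "S \<in> D \<and> (\<forall>s\<in>S. S - {s} \<in> D)" if S: "S \<subseteq> M" "card S = k" for S
    proof -
      have "\<not> S \<subseteq> {s}" for s
        using S(2) \<open>k > 1\<close> card_mono[of "{s}" S] by auto
      then have "S - {s} \<in> D" "S \<in> D" for s
        using S(1) mem[of "S - {s}"] mem[of S] by auto
      then show ?thesis
        by blast
    qed
    then show ?thesis
      using sub unfolding full_level_def by blast
  qed
  have "card M \<in> {0, 1, 2, 3, 4, 5, 6}"
    using assms(2) by auto
  then show ?thesis
    using fin by (auto simp: local_order_def lev full n_subsets numeral_eq_Suc)
qed

lemma singletons_dominate: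
  assumes "{a} \<in> D" "b \<in> M" "a \<noteq> b"
  shows "{a, b} \<in> level D 2"
  using assms up[of "{a}" "{a, b}"] sub by (auto simp: level_def)

text \<open>The elements whose singletons lie in \<open>D\<close> dominate the graph of pairs, so
  \<open>pairs_ge_dominating\<close> applies with these as \<open>K\<close>.\<close>

lemma pairs_ge_singletons:
  "card M choose 2 \<le> card (level D 2) + (card M - card (level D 1) choose 2)"
proof -
  let ?K = "{a \<in> M. {a} \<in> D}"
  have "level D 1 = (\<lambda>a. {a}) ` ?K"
    using sub by (auto simp: level_def card_1_singleton_iff)
  then have "card (level D 1) = card ?K"
    by (simp add: card_image)
  moreover have "card M choose 2 \<le> card (level D 2) + (card M - card ?K choose 2)"
  proof (rule pairs_ge_dominating[OF fin])
    show "level D 2 \<subseteq> Pow M"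
      using sub by (auto simp: level_def)
    show "{a, b} \<in> level D 2" if "a \<in> ?K" "b \<in> M" "a \<noteq> b" for a b
      using that by (intro singletons_dominate) auto
  qed (auto simp: level_def)
  ultimately show ?thesis
    by simp
qed

lemma card_singletons_less:
  assumes "a \<in> M" "{a} \<notin> D"
  shows "card (level D 1) < card M"
proof -
  have "level D 1 \<subseteq> (\<lambda>a. {a}) ` (M - {a})"
    using sub assms by (auto simp: level_def card_1_singleton_iff)
  then have "card (level D 1) \<le> card (M - {a})"
    using fin by (metis (no_types, lifting) card_image_le card_mono finite_Diff finite_imageI order_trans)
  then show ?thesis
    using assms fin by (metis card_Diff1_less order_le_less_trans)
qed

text \<open>A single dominating vertex already yields \<open>card M - 1\<close> pairs.\<close>

lemma card_le_pairs:
  assumes "card (level D 1) < card M"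
  shows "card (level D 1) \<le> card (level D 2)"
proof (cases "card (level D 1) = 0")
  case False
  then obtain S where "S \<in> level D 1"
    by (metis card.empty ex_in_conv)
  then obtain a where a: "{a} \<in> D" "a \<in> M"
    using sub by (auto simp: level_def card_1_singleton_iff)
  have "card M - 1 = card ((\<lambda>b. {a, b}) ` (M - {a}))"
    using a fin by (subst card_image) (auto simp: inj_on_def doubleton_eq_iff)
  also have "\<dots> \<le> card (level D 2)"
    using singletons_dominate[OF a(1)] finite_D
    by (intro card_mono) (auto simp: level_def)
  finally show ?thesis
    using assms by simp
qed simp

text \<open>Deleting \<open>i\<close> and \<open>j\<close> costs \<open>S\<close> at most one
  element, and a full triple survives that with a member of \<open>D\<close> left over. By
  up-closure \<open>M - {i, j}\<close> is then in \<open>D\<close>; the contrapositive excludes full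
  triples below.\<close>

lemma full_triple_pair:
  assumes "S \<in> full_level D 3" "i \<notin> S \<or> i = j"
  shows "\<exists>P\<in>D. P \<subseteq> S - {i, j}"
proof (cases "j \<in> S")
  case True
  have "S - {i, j} = S - {j}"
    using assms(2) by auto
  then show ?thesis
    using assms True by (auto simp: full_level_def)
next
  case False
  then have "S - {i, j} = S"
    using assms(2) by auto
  then show ?thesis
    using assms by (auto simp: full_level_def)
qed

lemma local_order_nonneg:
  assumes m: "card M \<le> 5" and lt: "card (level D 1) < card M"
  shows "local_order D \<ge> 0"
proof (cases "card M = 5")
  case True
  have [simp]: "full_level D 6 = {}"
    using full_level_empty[of 6] True by simp
  have V: "S = M" if "S \<in> D" "card S = 5" for S
    using that sub True fin card_subset_eq[of M S] by auto
  show ?thesis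
  \<comment> \<open>A missing 4-set rules out full triples and full 5-sets, so
    \<open>card_le_pairs\<close> suffices. If none is missing, the five 4-sets and \<open>M\<close>
    give 6, which balances the -2 of a full 5-set and at most four singletons, while full triples do
    not outnumber pairs.\<close>
  proof (cases "\<exists>i\<in>M. M - {i} \<notin> D")
    case True
    then obtain i where i: "i \<in> M" "M - {i} \<notin> D"
      by blast
    have "full_level D 3 = {}"
    proof -
      have False if S: "S \<in> full_level D 3" for S
      proof -
        obtain P where "P \<in> D" "P \<subseteq> S - {i, i}"
          using full_triple_pair[OF S, of i i] by blast
        moreover have "S \<subseteq> M"
          using S sub by (auto simp: full_level_def)
        ultimately show False
          using up[of P "M - {i}"] i(2) by auto
      qed
      then show ?thesis
        by blast
    qed
    moreover have "full_level D 5 = {}"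
      using V i by (auto simp: full_level_def)
    ultimately show ?thesis
      using card_le_pairs[OF lt] by (simp add: local_order_def)
  next
    case False
    have "(\<lambda>i. M - {i}) ` M \<subseteq> level D 4"
      using False \<open>card M = 5\<close> fin by (auto simp: level_def)
    then have "card ((\<lambda>i. M - {i}) ` M) \<le> card (level D 4)"
      using finite_level by (intro card_mono)
    moreover have "card ((\<lambda>i. M - {i}) ` M) = 5"
      using \<open>card M = 5\<close> by (subst card_image) (auto simp: inj_on_def)
    moreover have "M \<in> level D 5"
    proof -
      have "M \<noteq> {}" using \<open>card M = 5\<close> by auto
      then obtain i where "i \<in> M" by blast
      then show ?thesis using False up[of "M - {i}" M] \<open>card M = 5\<close> by (auto simp: level_def)
    qed
    then have "level D 5 = {M}" 
      using V by (auto simp: level_def)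
    moreover have "full_level D 5 \<subseteq> {M}"
      using V by (auto simp: full_level_def)
    then have "card (full_level D 5) \<le> 1"
      using card_mono[of "{M}"] by simp
    ultimately show ?thesis
      using triple_full_count[OF fin sub] lt \<open>card M = 5\<close> by (simp add: local_order_def)
  qed
next
  case False
  then have "card M \<in> {0, 1, 2, 3, 4}"
    using m by auto
  moreover have [simp]: "full_level D 6 = {}" "full_level D 5 = {}" "level D 5 = {}"
    using full_level_empty[of 6] full_level_empty[of 5] level_empty[of 5] m False by auto
  \<comment> \<open>With three singletons in a 4-set the bounds on pairs and full triples alone give
    only -1; the member \<open>M\<close> supplies the missing unit.\<close>
  have four: "card (level D 4) \<ge> 1" if M4: "card M = 4" "card (level D 1) > 0"
  proof -
    obtain S where "S \<in> D"
      using M4(2) by (auto simp: level_def card_gt_0_iff)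
    then have "M \<in> level D 4"
      using M4(1) up[of S M] sub by (auto simp: level_def)
    then show ?thesis
      using card_mono[OF finite_level, of "{M}" 4] by simp
  qed
  have "card (level D 1) \<in> {0, 1, 2, 3}"
    using lt False m by auto
  ultimately show ?thesis
    using triple_full_count[OF fin sub] pairs_ge_singletons lt four
    by (auto simp: local_order_def choose_two)
qed

text \<open>A proper subset of \<open>M\<close> in \<open>D\<close> would enlarge to a 5-set in
  \<open>D\<close>. Hence \<open>M\<close> is the only possible member, it is not full, and every
  term vanishes.\<close>

lemma local_order_eq_0:
  assumes "card M = 6" "level D 5 = {}"
  shows "local_order D = 0"
proof -
  have no5: "M - {i} \<notin> D" if "i \<in> M" for i
    using that assms fin by (auto simp: level_def)
  have "S = M" if S: "S \<in> D" for S
  proof (rule ccontr)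
    assume "S \<noteq> M"
    then obtain i where "i \<in> M" "i \<notin> S" using S sub by blast
    then show False using no5 up[OF S, of "M - {i}"] S sub by auto
  qed
  then have "card S = 6" if "S \<in> D" for S
    using that assms(1) by blast
  then have "level D k = {}" "full_level D k = {}" if "k \<noteq> 6" for k
    using that by (auto simp: level_def full_level_def)
  moreover have "full_level D 6 = {}"
  proof -
    have False if S: "S \<in> full_level D 6" for S
    proof -
      have "S = M" "M \<noteq> {}"
        using S \<open>\<And>S. S \<in> D \<Longrightarrow> S = M\<close> assms(1) by (auto simp: full_level_def)
      then show False
        using S no5 by (auto simp: full_level_def)
    qed
    then show ?thesis by blast
  qed
  ultimately show ?thesis
    by (simp add: local_order_def)
qed

lemma local_order_pos:
  assumes m: "card M = 6" and lt: "card (level D 1) < 6" and ne: "level D 5 \<noteq> {}"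
  shows "local_order D > 0"
proof -
  \<comment> \<open>\<open>K\<close> consists of the dominating vertices of the graph whose edges
    are the \<open>{i, j}\<close> with \<open>M - {i, j}\<close> in \<open>D\<close>. Every full
    5-set is \<open>M - {i}\<close> for some \<open>i\<close> in \<open>K\<close>.\<close>
  define K where "K = {i \<in> M. \<forall>j\<in>M - {i}. M - {i, j} \<in> D}"
  have "level D 5 \<subseteq> (\<lambda>i. M - {i}) ` M"
  proof
    fix S assume S: "S \<in> level D 5"
    then have "card (M - S) = 1"
      using sub m fin by (subst card_Diff_subset) (auto simp: level_def intro: finite_subset)
    then obtain i where "M - S = {i}"
      using card_1_singletonE by blast
    then have "S = M - {i}" "i \<in> M"
      using S sub by (auto simp: level_def)
    then show "S \<in> (\<lambda>i. M - {i}) ` M" by blast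
  qed
  then have five_eq: "\<exists>i\<in>M. S = M - {i}" if "S \<in> D" "card S = 5" for S
    using that by (auto simp: level_def)
  have "S \<in> (\<lambda>i. M - {i}) ` K" if S: "S \<in> full_level D 5" for S
  proof -
    obtain i where i: "i \<in> M" "S = M - {i}"
      using S five_eq by (auto simp: full_level_def)
    have "M - {i, j} \<in> D" if "j \<in> M - {i}" for j
    proof -
      have "S - {j} \<in> D"
        using S i that by (simp add: full_level_def)
      also have "S - {j} = M - {i, j}"
        using i by auto
      finally show ?thesis .
    qed
    then show ?thesis
      using i by (simp add: K_def)
  qed
  then have "full_level D 5 \<subseteq> (\<lambda>i. M - {i}) ` K"
    by blast
  moreover have finK: "finite K"
    using fin by (simp add: K_def)
  ultimately have "card (full_level D 5) \<le> card ((\<lambda>i. M - {i}) ` K)"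
    by (intro card_mono) auto
  also have "\<dots> \<le> card K"
    using finK by (rule card_image_le)
  finally have fK: "card (full_level D 5) \<le> card K" .
  show ?thesis
  proof (cases "K = {}")
    case True
    \<comment> \<open>Every point lies in a two-element vertex cover of the graph of pairs, which excludes triangles.\<close>
    have "full_level D 3 = {}"
    proof -
      have False if S: "S \<in> full_level D 3" for S
      proof -
        have "S \<subseteq> M" "S \<noteq> M"
          using S sub m by (auto simp: full_level_def)
        then obtain i where i: "i \<in> M" "i \<notin> S" by (meson psubsetI psubset_imp_ex_mem DiffD1 DiffD2)
        then obtain j where j: "j \<in> M" "M - {i, j} \<notin> D"
          using True by (auto simp: K_def)
        show False
          using full_triple_pair[OF S, of i j] up[of _ "M - {i, j}"] i j \<open>S \<subseteq> M\<close> by blast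
      qed
      then show ?thesis by blast
    qed
    moreover have "card (level D 5) > 0"
      using ne finite_level by (simp add: card_gt_0_iff)
    ultimately show ?thesis
      using card_le_pairs lt m fK True by (simp add: local_order_def)
  next
    case False
    then obtain i where i: "i \<in> M" "\<And>j. j \<in> M - {i} \<Longrightarrow> M - {i, j} \<in> D"
      by (auto simp: K_def)
    have five: "M - {j} \<in> D" if "j \<in> M" for j
    proof (cases "j = i")
      case True
      have "M \<noteq> {i}" using m by auto
      then obtain l where "l \<in> M - {i}" using i by blast
      then show ?thesis using i(2)[of l] up[of "M - {i, l}" "M - {j}"] True by auto
    next
      case False
      then show ?thesis using i(2)[of j] up[of "M - {i, j}" "M - {j}"] that by auto
    qed
    have "card ((\<lambda>i. M - {i}) ` M) \<le> card (level D 5)"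
      using five fin m finite_level by (intro card_mono) (auto simp: level_def)
    moreover have "card ((\<lambda>i. M - {i}) ` M) = 6"
      using m by (subst card_image) (auto simp: inj_on_def)
    ultimately have l5: "card (level D 5) \<ge> 6" by simp
    have "M \<in> full_level D 6"
      using five i(1) up[of "M - {i}" M] m by (auto simp: full_level_def)
    then have l6: "card (full_level D 6) \<ge> 1"
      using card_mono[OF finite_full_level, of "{M}" 6] by simp
    \<comment> \<open>Complements turn the 4-sets of \<open>D\<close> into the edges of a graph on \<open>M\<close> dominated by \<open>K\<close>.\<close>
    have "inj_on (\<lambda>S. M - S) (level D 4)"
      by (rule inj_on_inverseI[where g = "\<lambda>S. M - S"]) (use sub in \<open>auto simp: level_def\<close>)
    then have "card ((\<lambda>S. M - S) ` level D 4) = card (level D 4)"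
      by (rule card_image)
    moreover have "card (M - S) = 2" if "S \<in> level D 4" for S
      using that sub m fin by (subst card_Diff_subset) (auto simp: level_def intro: finite_subset)
    moreover have "{a, b} \<in> (\<lambda>S. M - S) ` level D 4" if "a \<in> K" "b \<in> M" "a \<noteq> b" for a b
    proof -
      have "M - {a, b} \<in> level D 4" "{a, b} = M - (M - {a, b})"
        using that fin m by (auto simp: K_def level_def)
      then show ?thesis by blast
    qed
    ultimately have "6 choose 2 \<le> card (level D 4) + (6 - card K choose 2)"
      using pairs_ge_dominating[OF fin, of "(\<lambda>S. M - S) ` level D 4" K] m by (auto simp: K_def)
    moreover have "card K \<in> {1, 2, 3, 4, 5, 6}"
    proof -
      have "card K \<le> 6" "card K \<noteq> 0"
        using m fin card_mono[of M K] False by (auto simp: K_def)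
      then show ?thesis by auto
    qed
    \<comment> \<open>This linear bound on \<open>15 - (6 - card K choose 2)\<close> cancels the
      term from full 5-sets. What remains is at least 3 + 6 + 2 from the 4-sets, the 5-sets and
      \<open>M\<close>, against at most 5 singletons and an excess of full triples over pairs of at
      most 15/3 = 5.\<close>
    ultimately have "card (level D 4) \<ge> 2 * card K + 3"
      by (auto simp: numeral_eq_Suc)
    moreover have "3 * card (full_level D 3) \<le> 4 * card (level D 2)"
      using triple_full_count[OF fin sub] m by simp
    moreover have "card (level D 2) \<le> 15"
    proof -
      have "card (level D 2) \<le> card {P. P \<subseteq> M \<and> card P = 2}"
        using fin sub by (intro card_mono) (auto simp: level_def)
      then show ?thesis using fin m by (simp add: n_subsets numeral_eq_Suc)
    qed
    ultimately show ?thesis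
      using l5 l6 fK lt by (simp add: local_order_def)
  qed
qed

end

section \<open>The order of \<open>\<psi>\<close> along a fibre of the projection\<close>

definition ind :: "6 set \<Rightarrow> box" where
  "ind S = (\<chi> i. of_bool (i \<in> S))"

text \<open>Stated by addition to avoid truncated subtraction: \<open>S\<close> then automatically
  lies in the support of \<open>v\<close>, and \<open>b\<close> is determined by \<open>S\<close>
  and \<open>v\<close>.\<close>

definition slice :: "box set \<Rightarrow> box \<Rightarrow> 6 set set" where
  "slice \<Delta> v = {S. \<exists>b\<in>\<Delta>. b + ind S = v}"

lemma ind_component [simp]: "ind S $ i = of_bool (i \<in> S)"
  by (simp add: ind_def)

lemma ind_empty [simp]: "ind {} = 0"
  by (simp add: vec_eq_iff)

lemma ind_UNIV: "ind UNIV = vec 1"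
  by (simp add: vec_eq_iff)

lemma ind_singleton: "ind {k} = axis k 1"
  by (simp add: vec_eq_iff axis_def)

lemma card_compl: "card (- S) = 6 - card S" for S :: "6 set"
  by (simp add: Compl_eq_Diff_UNIV card_Diff_subset)

lemma ind_remove: "s \<in> S \<Longrightarrow> axis s 1 + ind (S - {s}) = ind S"
  by (auto simp: vec_eq_iff axis_def)

lemma proj_add: "proj h (v + w) = proj h v + proj h w"
  by (simp add: proj_def sum.distrib algebra_simps)

lemma proj_ind: "proj h (ind S) = (\<Sum>a\<in>S. h $ a)" for h :: "complex ^ 6"
  by (simp add: proj_def of_bool_def if_distrib[of of_nat] if_distrib[of "\<lambda>x. x * _"] sum.If_cases
      cong: if_cong)

lemma proj_vec:
  fixes h :: "complex ^ 6"
  assumes "(\<Sum>i\<in>UNIV. h $ i) = 0"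
  shows "proj h (vec n) = 0"
  using assms by (simp add: proj_def flip: sum_distrib_left)

text \<open>Genericity makes \<open>v - y\<close> constant as an integer vector; the zero coordinate
  of \<open>y\<close> makes that constant the natural number \<open>v $ j\<close>.\<close>

lemma proj_eq_iff:
  fixes h :: "complex ^ 6" and y :: box
  assumes gen: "generic h" and sum0: "(\<Sum>i\<in>UNIV. h $ i) = 0" and j: "y $ j = 0"
  shows "proj h v = proj h y \<longleftrightarrow> (\<exists>n. v = y + vec n)"
proof
  assume eq: "proj h v = proj h y"
  define m :: "int ^ 6" where "m = (\<chi> i. int (v $ i) - int (y $ i))"
  have "(\<Sum>i\<in>UNIV. of_int (m $ i) * h $ i) = proj h v - proj h y"
    by (simp add: m_def proj_def sum_subtractf algebra_simps)
  then have m: "m $ i = m $ j" for i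
    using gen eq unfolding generic_def by simp
  have "int (v $ i) = int (y $ i) + int (v $ j)" for i
    using m[of i] j by (simp add: m_def)
  then have "v $ i = y $ i + v $ j" for i
    by (metis of_nat_add of_nat_eq_iff)
  then have "v = y + vec (v $ j)"
    unfolding vec_eq_iff vector_add_component vec_component by blast
  then show "\<exists>n. v = y + vec n" ..
qed (auto simp: proj_add proj_vec[OF sum0])

text \<open>The smallest coordinate is subtracted from all six.\<close>

lemma obtain_fibre_bottom:
  fixes v :: box
  obtains y :: box and j n where "v = y + vec n" "y $ j = 0"
proof -
  define n where "n = Min (range (\<lambda>i. v $ i))"
  have le: "n \<le> v $ i" for i
    by (simp add: n_def)
  have "n \<in> range (\<lambda>i. v $ i)"
    unfolding n_def by (rule Min_in) auto
  then obtain j where "v $ j = n"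
    by auto
  then show ?thesis
    using le by (intro that[of "\<chi> i. v $ i - n" n j]) (auto simp: vec_eq_iff)
qed

lemma finite_slices:
  assumes "finite \<Delta>"
  shows "finite {v. slice \<Delta> v \<noteq> {} \<and> P v}"
proof (rule finite_subset)
  show "{v. slice \<Delta> v \<noteq> {} \<and> P v} \<subseteq> (\<lambda>(b, S). b + ind S) ` (\<Delta> \<times> UNIV)"
    by (force simp: slice_def)
qed (use assms in simp)

text \<open>Pairs \<open>(b, S)\<close> are regrouped by the lattice point
  \<open>v = b + ind S\<close>. Over a fixed \<open>v\<close> the set \<open>S\<close> determines
  \<open>b\<close>, so counting pairs is counting sets. The condition of nonempty slice keeps the
  outer sum finite.\<close>

lemma fibre_count:
  assumes fin: "finite \<Delta>" and X: "X \<subseteq> \<Delta> \<times> UNIV"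
  shows "(\<Sum>x\<in>X. of_bool (z = proj_cluster h x)) =
    (\<Sum>v | slice \<Delta> v \<noteq> {} \<and> proj h v = z. int (card {S. \<exists>b. (b, S) \<in> X \<and> b + ind S = v}))"
proof -
  let ?V = "{v. slice \<Delta> v \<noteq> {} \<and> proj h v = z}"
  define g where "g = (\<lambda>(b, S). b + ind S)"
  define X' where "X' = {x \<in> X. z = proj_cluster h x}"
  have pc: "proj_cluster h x = proj h (g x)" for x
    by (simp add: proj_cluster_def g_def proj_add proj_ind split: prod.split)
  have "finite X"
    using fin X by (rule_tac finite_subset) auto
  then have fX: "finite X'" "finite X"
    by (auto simp: X'_def)
  have fV: "finite ?V"
    using fin by (rule finite_slices)
  have gV: "g ` X' \<subseteq> ?V"
    using X by (auto simp: X'_def pc slice_def) (force simp: g_def)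
  have "(\<Sum>x\<in>X. of_bool (z = proj_cluster h x)) = int (card X')"
    using fX by (simp add: X'_def of_bool_def sum.If_cases Int_def)
  also have "card X' = (\<Sum>v\<in>?V. card {x \<in> X'. g x = v})"
    using sum.group[OF fX(1) fV gV, of "\<lambda>_. 1::nat"] by simp
  also have "\<dots> = (\<Sum>v\<in>?V. card {S. \<exists>b. (b, S) \<in> X \<and> b + ind S = v})"
  proof (rule sum.cong[OF refl])
    fix v assume v: "v \<in> ?V"
    have "{S. \<exists>b. (b, S) \<in> X \<and> b + ind S = v} = snd ` {x \<in> X'. g x = v}"
      using v by (force simp: X'_def pc g_def)
    moreover have "inj_on snd {x \<in> X'. g x = v}"
      by (auto simp: inj_on_def g_def)
    ultimately show "card {x \<in> X'. g x = v} = card {S. \<exists>b. (b, S) \<in> X \<and> b + ind S = v}"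
      by (simp add: card_image)
  qed
  finally show ?thesis
    by simp
qed

lemma level_count:
  fixes h :: "complex ^ 6"
  assumes "finite \<Delta>"
  shows "(\<Sum>b\<in>\<Delta>. \<Sum>S | card S = k. of_bool (z = proj h b + (\<Sum>a\<in>S. h $ a))) =
    (\<Sum>v | slice \<Delta> v \<noteq> {} \<and> proj h v = z. int (card (level (slice \<Delta> v) k)))"
proof -
  have lev: "{S. \<exists>b. (b, S) \<in> \<Delta> \<times> {S. card S = k} \<and> b + ind S = v} = level (slice \<Delta> v) k" for v
    by (auto simp: level_def slice_def)
  have "(\<Sum>b\<in>\<Delta>. \<Sum>S | card S = k. of_bool (z = proj h b + (\<Sum>a\<in>S. h $ a))) =
    (\<Sum>x\<in>\<Delta> \<times> {S. card S = k}. of_bool (z = proj_cluster h x) :: int)"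
    unfolding sum.cartesian_product proj_cluster_def split_def by simp
  also have "\<dots> = (\<Sum>v | slice \<Delta> v \<noteq> {} \<and> proj h v = z.
      int (card {S. \<exists>b. (b, S) \<in> \<Delta> \<times> {S. card S = k} \<and> b + ind S = v}))"
    by (rule fibre_count[OF assms]) auto
  finally show ?thesis
    unfolding lev .
qed

text \<open>If \<open>b + ind S = v\<close>, then the box lying \<open>ind (S - {s})\<close> below
  \<open>v\<close> is \<open>b + axis s 1\<close>, so the facets of \<open>S\<close> in the slice
  are the remaining boxes of the cluster.\<close>

lemma cluster_slice:
  "{S. \<exists>b. (b, S) \<in> clusters_in (Suc k) \<Delta> \<and> b + ind S = v} = full_level (slice \<Delta> v) k"
  (is "?L = ?R")
proof (intro set_eqI iffI)
  fix S assume "S \<in> ?L"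
  then obtain b where b: "card S = k" "b \<in> \<Delta>" "\<And>s. s \<in> S \<Longrightarrow> b + axis s 1 \<in> \<Delta>" "b + ind S = v"
    by (auto simp: clusters_in_def cluster_def)
  have "b + axis s 1 + ind (S - {s}) = v" if "s \<in> S" for s
    using b(4) ind_remove[OF that] by (simp add: add.assoc)
  then show "S \<in> ?R"
    using b by (auto simp: full_level_def slice_def)
next
  fix S assume S: "S \<in> ?R"
  then obtain b where b: "b \<in> \<Delta>" "b + ind S = v"
    by (auto simp: full_level_def slice_def)
  have "b + axis s 1 \<in> \<Delta>" if s: "s \<in> S" for s
  proof -
    obtain c where c: "c \<in> \<Delta>" "c + ind (S - {s}) = v"
      using S s by (auto simp: full_level_def slice_def)
    have "c + ind (S - {s}) = (b + axis s 1) + ind (S - {s})"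
      using c b ind_remove[OF s] by (simp add: add.assoc)
    then show ?thesis
      using c(1) by simp
  qed
  then show "S \<in> ?L"
    using S b by (auto simp: clusters_in_def cluster_def full_level_def)
qed

lemma cluster_count:
  assumes "finite \<Delta>"
  shows "(\<Sum>\<phi>\<in>clusters_in (Suc k) \<Delta>. of_bool (z = proj_cluster h \<phi>)) =
    (\<Sum>v | slice \<Delta> v \<noteq> {} \<and> proj h v = z. int (card (full_level (slice \<Delta> v) k)))"
proof -
  have "clusters_in (Suc k) \<Delta> \<subseteq> \<Delta> \<times> UNIV"
    by (auto simp: clusters_in_def cluster_def)
  from fibre_count[OF assms this] show ?thesis
    by (simp only: cluster_slice)
qed

lemma psi_order:
  fixes h :: "complex ^ 6"
  assumes sum0: "(\<Sum>i\<in>UNIV. h $ i) = 0" and fin: "finite \<Delta>"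
  shows "has_order (psi h \<Delta>) z
    (- of_bool (z = 0) + (\<Sum>v | slice \<Delta> v \<noteq> {} \<and> proj h v = z. local_order (slice \<Delta> v)))"
proof -
  have one: "(\<Sum>i\<in>UNIV. of_bool (z = p + h $ i)) =
      (\<Sum>S | card S = 1. of_bool (z = p + (\<Sum>a\<in>S. h $ a)) :: int)" for p
  proof (rule sum.reindex_bij_witness[where i = the_elem and j = "\<lambda>i. {i}"])
  qed (auto simp: card_1_singleton_iff)
  have five: "(\<Sum>i\<in>UNIV. of_bool (z = p - h $ i)) =
      (\<Sum>S | card S = 5. of_bool (z = p + (\<Sum>a\<in>S. h $ a)) :: int)" for p
  proof (rule sum.reindex_bij_witness[where i = "\<lambda>S. the_elem (- S)" and j = "\<lambda>i. - {i}"])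
    fix S :: "6 set" assume "S \<in> {S. card S = 5}"
    then have "card (- S) = 1"
      by (simp add: card_compl)
    then obtain i where "- S = {i}"
      using card_1_singletonE by blast
    then show "- {the_elem (- S)} = S"
      by (metis double_complement the_elem_eq)
  next
    fix i :: 6
    have "(\<Sum>a\<in>- {i}. h $ a) = - h $ i"
      using sum0 sum.remove[of UNIV i "\<lambda>a. h $ a"] by (simp add: Compl_eq_Diff_UNIV eq_neg_iff_add_eq_0 add.commute)
    then show "of_bool (z = p + (\<Sum>a\<in>- {i}. h $ a)) = (of_bool (z = p - h $ i) :: int)"
      by simp
  qed (auto simp: card_compl)
  let ?V = "{v. slice \<Delta> v \<noteq> {} \<and> proj h v = z}"
  have boxes: "(\<Sum>b\<in>\<Delta>. (\<Sum>i\<in>UNIV. of_bool (z = proj h b - h $ i)) - (\<Sum>i\<in>UNIV. of_bool (z = proj h b + h $ i))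
           + (\<Sum>A | card A = 2. of_bool (z = proj h b + (\<Sum>a\<in>A. h $ a)))
           + (\<Sum>A | card A = 4. of_bool (z = proj h b + (\<Sum>a\<in>A. h $ a)))) =
    (\<Sum>v\<in>?V. int (card (level (slice \<Delta> v) 5)) - int (card (level (slice \<Delta> v) 1))
       + int (card (level (slice \<Delta> v) 2)) + int (card (level (slice \<Delta> v) 4)))"
    unfolding one five sum.distrib sum_subtractf level_count[OF fin] ..
  have four: "(\<Sum>\<phi>\<in>clusters_in 4 \<Delta>. - of_bool (z = proj_cluster h \<phi>)) =
      (\<Sum>v\<in>?V. - int (card (full_level (slice \<Delta> v) 3)))"
    using cluster_count[OF fin, of z h 3] by (simp add: sum_negf)
  have six: "(\<Sum>\<phi>\<in>clusters_in 6 \<Delta>. - (2 * of_bool (z = proj_cluster h \<phi>))) =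
      (\<Sum>v\<in>?V. - (2 * int (card (full_level (slice \<Delta> v) 5))))"
    using cluster_count[OF fin, of z h 5] by (simp add: sum_negf flip: sum_distrib_left)
  have seven: "(\<Sum>\<phi>\<in>clusters_in 7 \<Delta>. 2 * of_bool (z = proj_cluster h \<phi>)) =
      (\<Sum>v\<in>?V. 2 * int (card (full_level (slice \<Delta> v) 6)))"
    using cluster_count[OF fin, of z h 6] by (simp flip: sum_distrib_left)
  have "(\<Sum>v\<in>?V. local_order (slice \<Delta> v)) =
    (\<Sum>v\<in>?V. int (card (level (slice \<Delta> v) 5)) - int (card (level (slice \<Delta> v) 1))
       + int (card (level (slice \<Delta> v) 2)) + int (card (level (slice \<Delta> v) 4)))
    + (\<Sum>v\<in>?V. - int (card (full_level (slice \<Delta> v) 3)))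
    + (\<Sum>v\<in>?V. - (2 * int (card (full_level (slice \<Delta> v) 5))))
    + (\<Sum>v\<in>?V. 2 * int (card (full_level (slice \<Delta> v) 6)))"
    unfolding sum.distrib[symmetric] by (rule sum.cong) (simp_all add: local_order_def)
  then show ?thesis
    using has_order_psi[of h \<Delta> z] unfolding boxes four six seven by (simp only: add.assoc)
qed

section \<open>Slices of a partition\<close>

context
  fixes \<Delta> :: "box set"
  assumes part: "is_partition \<Delta>"
begin

text \<open>Induction on the coordinate sum: \<open>b\<close> is lowered by one in a coordinate
  where it exceeds \<open>b'\<close>.\<close>

lemma partition_le: "b \<in> \<Delta> \<Longrightarrow> b' \<le> b \<Longrightarrow> b' \<in> \<Delta>"
proof (induction "\<Sum>i\<in>UNIV. b $ i" arbitrary: b rule: less_induct)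
  case less
  show ?case
  proof (cases "b' = b")
    case False
    then obtain k where "b' $ k \<noteq> b $ k"
      by (auto simp: vec_eq_iff)
    then have k: "b' $ k < b $ k"
      using less.prems(2) by (simp add: less_eq_vec_def le_neq_implies_less)
    define c where "c = b - axis k 1"
    have b: "b = c + axis k 1"
      using k by (auto simp: c_def vec_eq_iff axis_def)
    have "c \<in> \<Delta>"
      using part less.prems(1) b unfolding is_partition_def by blast
    moreover have "b' \<le> c"
      using less.prems(2) k by (auto simp: c_def less_eq_vec_def axis_def)
    moreover have "(\<Sum>i\<in>UNIV. c $ i) < (\<Sum>i\<in>UNIV. b $ i)"
      by (rule sum_strict_mono_ex1) (auto simp: b axis_def intro: exI[of _ k])
    ultimately show ?thesis
      using less.hyps by blast
  qed (use less.prems in simp)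
qed

lemma upset_slice: "upset {i. v $ i \<noteq> 0} (slice \<Delta> v)"
proof
  show "slice \<Delta> v \<subseteq> Pow {i. v $ i \<noteq> 0}"
    by (auto simp: slice_def)
next
  fix S T assume S: "S \<in> slice \<Delta> v" "S \<subseteq> T" "T \<subseteq> {i. v $ i \<noteq> 0}"
  then obtain b where b: "b \<in> \<Delta>" "b + ind S = v"
    by (auto simp: slice_def)
  have eq: "v $ i = b $ i + of_bool (i \<in> S)" for i
    using b(2) by auto
  \<comment> \<open>Subtraction of naturals is exact here because \<open>T\<close> lies in the
    support of \<open>v\<close>.\<close>
  have T: "v - ind T + ind T = v"
    using S(3) by (auto simp: vec_eq_iff Suc_leI)
  have "v - ind T \<le> b"
    using S(2) by (auto simp: less_eq_vec_def eq)
  then have "v - ind T \<in> \<Delta>"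
    using b(1) partition_le by blast
  then show "T \<in> slice \<Delta> v"
    using T by (auto simp: slice_def)
qed simp

lemma empty_in_slice: "{} \<in> slice \<Delta> v \<longleftrightarrow> v \<in> \<Delta>"
  by (auto simp: slice_def)

text \<open>Inserting \<open>v\<close> adds only the closure conditions at the predecessors of
  \<open>v\<close>, which exist in the directions of its support.\<close>

lemma addable_iff: "v \<in> addable \<Delta> \<longleftrightarrow> v \<notin> \<Delta> \<and> (\<forall>i. v $ i \<noteq> 0 \<longrightarrow> {i} \<in> slice \<Delta> v)"
proof
  assume v: "v \<in> addable \<Delta>"
  have "{i} \<in> slice \<Delta> v" if "v $ i \<noteq> 0" for i
  proof -
    have eq: "v - axis i 1 + axis i 1 = v"
      using that by (auto simp: vec_eq_iff axis_def)
    then have "v - axis i 1 \<in> insert v \<Delta>"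
      using v unfolding addable_def is_partition_def by (metis (mono_tags, lifting) insertI1 mem_Collect_eq)
    moreover have "v - axis i 1 \<noteq> v"
      using that by (auto simp: vec_eq_iff axis_def intro!: exI[of _ i])
    ultimately show ?thesis
      using eq by (auto simp: slice_def ind_singleton)
  qed
  then show "v \<notin> \<Delta> \<and> (\<forall>i. v $ i \<noteq> 0 \<longrightarrow> {i} \<in> slice \<Delta> v)"
    using v by (simp add: addable_def)
next
  assume v: "v \<notin> \<Delta> \<and> (\<forall>i. v $ i \<noteq> 0 \<longrightarrow> {i} \<in> slice \<Delta> v)"
  have "b \<in> \<Delta>" if "b + axis k 1 = v" for b k
  proof -
    have "v $ k \<noteq> 0"
      using that by (auto simp: axis_def)
    then have "{k} \<in> slice \<Delta> v"
      using v by simp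
    then obtain c where "c \<in> \<Delta>" "c + axis k 1 = v"
      by (auto simp: slice_def ind_singleton)
    then show ?thesis
      using that add_right_cancel[of b "axis k 1" c] by simp
  qed
  then show "v \<in> addable \<Delta>"
    using v part by (auto simp: addable_def is_partition_def)
qed

text \<open>Removability means that no upper neighbour \<open>w + axis k 1\<close> is in the
  partition. Seen from \<open>w + vec 1\<close>, this neighbour corresponds to the five-element set
  \<open>- {k}\<close>.\<close>

lemma removable_iff: "w \<in> removable \<Delta> \<longleftrightarrow> w \<in> \<Delta> \<and> level (slice \<Delta> (w + vec 1)) 5 = {}"
proof -
  have "is_partition (\<Delta> - {w}) \<longleftrightarrow> (\<forall>k. w + axis k 1 \<notin> \<Delta>)"
  proof -
    have "w + axis k 1 \<noteq> w" for k
      by (auto simp: vec_eq_iff axis_def intro!: exI[of _ k])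
    then show ?thesis
      using part unfolding is_partition_def by (metis Diff_iff finite_Diff singletonD singletonI)
  qed
  also have "\<dots> \<longleftrightarrow> (\<forall>k. - {k} \<notin> slice \<Delta> (w + vec 1))"
  proof -
    have eq: "w + vec 1 = (w + axis k 1) + ind (- {k})" for k
      using ind_remove[of k UNIV] by (simp add: add.assoc ind_UNIV Compl_eq_Diff_UNIV)
    have "- {k} \<in> slice \<Delta> (w + vec 1) \<longleftrightarrow> w + axis k 1 \<in> \<Delta>" for k
      unfolding slice_def eq[of k] mem_Collect_eq add_right_cancel by blast
    then show ?thesis
      by simp
  qed
  also have "\<dots> \<longleftrightarrow> level (slice \<Delta> (w + vec 1)) 5 = {}"
  proof -
    have "\<exists>k. S = - {k}" if "card S = 5" for S :: "6 set"
    proof -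
      have "card (- S) = 1"
        using that by (simp add: card_compl)
      then show ?thesis
        by (metis card_1_singletonE double_complement)
    qed
    moreover have "card (- {k}) = 5" for k :: 6
      by (simp add: card_compl)
    ultimately show ?thesis
      by (auto simp: level_def)
  qed
  finally show ?thesis
    by (auto simp: removable_def)
qed

lemma singleton_in_slice:
  fixes v :: box
  assumes "v \<in> \<Delta>" "v $ i \<noteq> 0"
  shows "{i} \<in> slice \<Delta> v"
  using upset.up[OF upset_slice, of "{}" v "{i}"] assms by (auto simp: empty_in_slice)

text \<open>Covers both boxes of the partition and addable boxes. The -1 missing at the origin is
  later supplied by the factor \<open>1 / u\<close>.\<close>

lemma local_order_corner:
  fixes v :: box
  assumes "\<forall>i. v $ i \<noteq> 0 \<longrightarrow> {i} \<in> slice \<Delta> v"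
  shows "local_order (slice \<Delta> v) = - of_bool (v \<noteq> 0 \<and> (\<exists>j. v $ j = 0))"
proof -
  interpret upset "{i. v $ i \<noteq> 0}" "slice \<Delta> v" by (rule upset_slice)
  have "local_order (slice \<Delta> v) = - of_bool ({i. v $ i \<noteq> 0} \<noteq> {} \<and> card {i. v $ i \<noteq> 0} < 6)"
    by (rule local_order_all_singletons)
      (use assms card_mono[of UNIV "{i. v $ i \<noteq> 0}"] in auto)
  also have "{i. v $ i \<noteq> 0} \<noteq> {} \<longleftrightarrow> v \<noteq> 0"
    by (auto simp: vec_eq_iff)
  also have "card {i. v $ i \<noteq> 0} < 6 \<longleftrightarrow> (\<exists>j. v $ j = 0)"
  proof
    assume "card {i. v $ i \<noteq> 0} < 6"
    then have "{i. v $ i \<noteq> 0} \<noteq> UNIV"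
      by (intro notI) simp
    then show "\<exists>j. v $ j = 0"
      by auto
  next
    assume "\<exists>j. v $ j = 0"
    then have "{i. v $ i \<noteq> 0} \<subset> UNIV"
      by blast
    from psubset_card_mono[OF _ this] show "card {i. v $ i \<noteq> 0} < 6"
      by simp
  qed
  finally show ?thesis .
qed

text \<open>Any member of the slice would enlarge to \<open>UNIV\<close>, which places
  \<open>w\<close> itself in the partition.\<close>

lemma slice_above_outside:
  assumes "w \<notin> \<Delta>"
  shows "slice \<Delta> (w + vec 1) = {}"
proof -
  interpret upset "{i. (w + vec 1) $ i \<noteq> 0}" "slice \<Delta> (w + vec 1)" by (rule upset_slice)
  have "UNIV \<notin> slice \<Delta> (w + vec 1)"
    using assms by (auto simp: slice_def ind_UNIV)
  then show ?thesis
    using up[of _ UNIV] by auto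
qed

lemma fibre_outside:
  assumes "y + vec m \<notin> \<Delta>" "m \<le> n"
  shows "y + vec n \<notin> \<Delta>" "slice \<Delta> (y + vec (Suc n)) = {}"
proof -
  have "y + vec m \<le> y + vec n"
    using assms(2) by (simp add: less_eq_vec_def)
  then show *: "y + vec n \<notin> \<Delta>"
    using assms(1) partition_le by blast
  have "y + vec (Suc n) = (y + vec n) + vec 1"
    by (simp add: vec_eq_iff)
  then show "slice \<Delta> (y + vec (Suc n)) = {}"
    using slice_above_outside[OF *] by simp
qed

section \<open>The order of the function over one fibre\<close>

context
  fixes h :: "complex ^ 6"
  assumes gen: "generic h" and sum0: "(\<Sum>i\<in>UNIV. h $ i) = 0"
begin

text \<open>The fibre over 0 has the origin as its bottom, so \<open>z = 0\<close> turns into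
  \<open>y = 0\<close>.\<close>

lemma psi_order_fibre:
  fixes y :: box
  assumes j: "y $ j = 0"
  shows "has_order (psi h \<Delta>) (proj h y)
    (- of_bool (y = 0)
     + (\<Sum>v | slice \<Delta> v \<noteq> {} \<and> (\<exists>n. v = y + vec n). local_order (slice \<Delta> v)))"
proof -
  have "proj h y = proj h 0 \<longleftrightarrow> y = 0"
  proof
    assume "proj h y = proj h 0"
    then obtain n where n: "y = 0 + vec n"
      using proj_eq_iff[OF gen sum0, of 0 j y] by auto
    then show "y = 0"
      using j by (simp add: vec_eq_iff)
  qed simp
  moreover have "proj h 0 = 0"
    by (simp add: proj_def)
  ultimately show ?thesis
    using psi_order[OF sum0, of \<Delta> "proj h y"] part
    by (simp add: proj_eq_iff[OF gen sum0 j] is_partition_def)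
qed

lemma order_bottom_outside:
  fixes y :: box
  assumes j: "y $ j = 0" and y: "y \<notin> \<Delta>"
  shows "\<exists>n \<ge> -1. has_order (psi h \<Delta>) (proj h y) n \<and>
    (n = -1 \<longleftrightarrow> (\<exists>b\<in>addable \<Delta> \<union> removable \<Delta>. proj h b = proj h y))"
proof -
  have out: "y + vec n \<notin> \<Delta>" "slice \<Delta> (y + vec (Suc n)) = {}" for n
    using fibre_outside[of y 0 n] y by (simp_all add: vec_eq_iff)
  have only: "n = 0" if "slice \<Delta> (y + vec n) \<noteq> {}" for n
    using that out(2) by (cases n) auto
  let ?V = "{v. slice \<Delta> v \<noteq> {} \<and> (\<exists>n. v = y + vec n)}"
  have y0: "y + vec 0 = y"
    by (simp add: vec_eq_iff)
  have "(\<Sum>v\<in>?V. local_order (slice \<Delta> v)) = (\<Sum>v\<in>{y}. local_order (slice \<Delta> v))"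
  proof (rule sum.mono_neutral_left)
    show "?V \<subseteq> {y}"
    proof
      fix v assume v: "v \<in> ?V"
      then obtain n where "v = y + vec n"
        by blast
      then show "v \<in> {y}"
        using v only[of n] y0 by simp
    qed
    \<comment> \<open>The slice at \<open>y\<close> may be empty, in which case \<open>y\<close> is
      absent from \<open>?V\<close>.\<close>
    show "\<forall>v\<in>{y} - ?V. local_order (slice \<Delta> v) = 0"
    proof
      fix v assume v: "v \<in> {y} - ?V"
      then have "\<exists>n. v = y + vec n"
        using y0[symmetric] by (intro exI[of _ 0]) simp
      then have "slice \<Delta> v = {}"
        using v by blast
      then show "local_order (slice \<Delta> v) = 0"
        by (simp add: local_order_def level_def full_level_def)
    qed
  qed simp
  then have order: "has_order (psi h \<Delta>) (proj h y) (- of_bool (y = 0) + local_order (slice \<Delta> y))"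
    using psi_order_fibre[OF j] by simp
  have ex: "(\<exists>b\<in>addable \<Delta> \<union> removable \<Delta>. proj h b = proj h y) \<longleftrightarrow> y \<in> addable \<Delta>"
  proof
    assume "\<exists>b\<in>addable \<Delta> \<union> removable \<Delta>. proj h b = proj h y"
    then obtain n where n: "y + vec n \<in> addable \<Delta> \<union> removable \<Delta>"
      by (auto simp: proj_eq_iff[OF gen sum0 j])
    then have add: "y + vec n \<in> addable \<Delta>"
      using out(1) by (auto simp: removable_def)
    have "n = 0"
    proof (rule ccontr)
      assume "n \<noteq> 0"
      \<comment> \<open>For \<open>n > 0\<close> the coordinate \<open>j\<close> is positive, so
        addability demands a member of a slice that is empty.\<close>
      then have "{j} \<in> slice \<Delta> (y + vec n)"
        using add by (auto simp: addable_iff)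
      then show False
        using only \<open>n \<noteq> 0\<close> by auto
    qed
    then show "y \<in> addable \<Delta>"
      using add y0 by simp
  qed auto
  interpret upset "{i. y $ i \<noteq> 0}" "slice \<Delta> y" by (rule upset_slice)
  show ?thesis
  proof (cases "y \<in> addable \<Delta>")
    case True
    then have "local_order (slice \<Delta> y) = - of_bool (y \<noteq> 0)"
      using local_order_corner[of y] j by (auto simp: addable_iff)
    then have "has_order (psi h \<Delta>) (proj h y) (-1)"
      using order by (cases "y = 0") simp_all
    then show ?thesis
      using ex True by (intro exI[of _ "-1"]) simp
  next
    case False
    then obtain i where i: "y $ i \<noteq> 0" "{i} \<notin> slice \<Delta> y"
      using y by (auto simp: addable_iff)
    have "{i. y $ i \<noteq> 0} \<subset> UNIV"
      using j by blast
    then have "card {i. y $ i \<noteq> 0} < card (UNIV :: 6 set)"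
      by (intro psubset_card_mono) simp_all
    then have "local_order (slice \<Delta> y) \<ge> 0"
      using i by (intro local_order_nonneg card_singletons_less[of i]) auto
    moreover have "y \<noteq> 0"
      using i by auto
    ultimately show ?thesis
      using order ex False by (intro exI[of _ "local_order (slice \<Delta> y)"]) simp
  qed
qed

lemma order_bottom_inside:
  fixes y :: box
  assumes j: "y $ j = 0" and y: "y \<in> \<Delta>"
  shows "\<exists>n \<ge> -1. has_order (psi h \<Delta>) (proj h y) n \<and>
    (n = -1 \<longleftrightarrow> (\<exists>b\<in>addable \<Delta> \<union> removable \<Delta>. proj h b = proj h y))"
proof -
  have fin: "finite \<Delta>"
    using part by (simp add: is_partition_def)
  have y0: "y + vec 0 = y"
    by (simp add: vec_eq_iff)
  have "inj (\<lambda>n. y + vec n)"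
    by (auto simp: inj_def vec_eq_iff)
  then have "\<not> range (\<lambda>n. y + vec n) \<subseteq> \<Delta>"
    using fin infinite_UNIV_nat by (metis finite_imageD finite_subset)
  then have "\<exists>n. y + vec n \<notin> \<Delta>"
    by auto
  define N where "N = (LEAST n. y + vec n \<notin> \<Delta>)"
  have N: "y + vec N \<notin> \<Delta>"
    unfolding N_def by (rule LeastI_ex) fact
  have below: "y + vec n \<in> \<Delta>" if "n < N" for n
    using not_less_Least[of n "\<lambda>n. y + vec n \<notin> \<Delta>"] that by (simp add: N_def)
  have above: "slice \<Delta> (y + vec n) = {}" if "n > N" for n
    using fibre_outside(2)[OF N, of "n - 1"] that by simp
  have above': "y + vec n \<notin> \<Delta>" if "n \<ge> N" for n
    using fibre_outside(1)[OF N that] .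
  have "N \<noteq> 0"
    using N y y0 by metis
  define t where "t = y + vec N"
  have tpos: "t $ i \<noteq> 0" for i
    using \<open>N \<noteq> 0\<close> by (simp add: t_def)
  let ?V = "{v. slice \<Delta> v \<noteq> {} \<and> (\<exists>n. v = y + vec n)}"
  have "(\<Sum>v\<in>?V. local_order (slice \<Delta> v)) = (\<Sum>v\<in>{y, t}. local_order (slice \<Delta> v))"
  proof (rule sum.mono_neutral_cong)
    show "finite ?V"
      using fin by (rule finite_slices)
    fix v
    show "local_order (slice \<Delta> v) = 0" if v: "v \<in> {y, t} - ?V"
    proof -
      have "\<exists>n. v = y + vec n"
      proof (cases "v = t")
        case False
        then show ?thesis
          using v y0[symmetric] by (intro exI[of _ 0]) simp
      qed (auto simp: t_def)
      then have "slice \<Delta> v = {}"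
        using v by blast
      then show ?thesis
        by (simp add: local_order_def level_def full_level_def)
    qed
    \<comment> \<open>Points strictly between \<open>y\<close> and \<open>t\<close> are boxes of the
      partition with all coordinates positive, so \<open>local_order_corner\<close> gives 0.\<close>
    show "local_order (slice \<Delta> v) = 0" if v: "v \<in> ?V - {y, t}"
    proof -
      obtain n where n: "v = y + vec n" "slice \<Delta> v \<noteq> {}"
        using v by blast
      then have "n \<noteq> 0" "n \<noteq> N" "\<not> n > N"
        using v above y0 by (auto simp: t_def)
      then have "v \<in> \<Delta>" "\<nexists>j. v $ j = 0"
        using below n(1) by auto
      then show ?thesis
        using local_order_corner[of v] singleton_in_slice by simp
    qed
  qed auto
  moreover have "y \<noteq> t"
    using \<open>N \<noteq> 0\<close> by (auto simp: t_def vec_eq_iff)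
  moreover have "local_order (slice \<Delta> y) = - of_bool (y \<noteq> 0)"
    using local_order_corner[of y] singleton_in_slice[OF y] j by auto
  ultimately have order: "has_order (psi h \<Delta>) (proj h y) (local_order (slice \<Delta> t) - 1)"
    using psi_order_fibre[OF j] by (cases "y = 0") simp_all
  \<comment> \<open>The last point of the line inside the partition; the slice at \<open>t\<close>
    decides whether it is removable.\<close>
  define w where "w = y + vec (N - 1)"
  have w: "w + vec 1 = t" "w \<in> \<Delta>"
    using \<open>N \<noteq> 0\<close> below[of "N - 1"] by (auto simp: w_def t_def vec_eq_iff)
  have ex: "(\<exists>b\<in>addable \<Delta> \<union> removable \<Delta>. proj h b = proj h y) \<longleftrightarrow>
      t \<in> addable \<Delta> \<or> w \<in> removable \<Delta>"
  proof
    assume "\<exists>b\<in>addable \<Delta> \<union> removable \<Delta>. proj h b = proj h y"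
    then obtain n where n: "y + vec n \<in> addable \<Delta> \<or> y + vec n \<in> removable \<Delta>"
      by (auto simp: proj_eq_iff[OF gen sum0 j])
    then show "t \<in> addable \<Delta> \<or> w \<in> removable \<Delta>"
    proof
      assume add: "y + vec n \<in> addable \<Delta>"
      then have "n \<ge> N"
        using below[of n] by (intro leI notI) (simp add: addable_iff)
      then have "{j} \<in> slice \<Delta> (y + vec n)"
        using add \<open>N \<noteq> 0\<close> by (auto simp: addable_iff)
      then have "n = N"
        using above[of n] \<open>n \<ge> N\<close> by force
      then show ?thesis
        using add by (simp add: t_def)
    next
      assume rem: "y + vec n \<in> removable \<Delta>"
      then have "n < N"
        using above'[of n] by (cases "n < N") (simp_all add: removable_iff)
      have "n = N - 1"
      \<comment> \<open>Below \<open>w\<close> the next point of the line is still inside, so its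
        slice contains the empty set and, by up-closure, a five-element set, which contradicts
        removability.\<close>
      proof (rule ccontr)
        assume "n \<noteq> N - 1"
        then have "y + vec (Suc n) \<in> \<Delta>"
          using below[of "Suc n"] \<open>n < N\<close> by simp
        moreover have suc: "y + vec (Suc n) = (y + vec n) + vec 1"
          by (simp add: vec_eq_iff)
        ultimately have "{} \<in> slice \<Delta> (y + vec n + vec 1)"
          by (simp only: empty_in_slice)
        then have "- {j} \<in> slice \<Delta> (y + vec n + vec 1)"
          using upset.up[OF upset_slice, of "{}" "y + vec n + vec 1" "- {j}"] by simp
        then show False
          using rem by (auto simp: removable_iff level_def card_compl)
      qed
      then show ?thesis
        using rem by (simp add: w_def)
    qed
  next
    have "proj h t = proj h y" "proj h w = proj h y"
      by (auto simp: t_def w_def proj_eq_iff[OF gen sum0 j])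
    then show "\<exists>b\<in>addable \<Delta> \<union> removable \<Delta>. proj h b = proj h y" if "t \<in> addable \<Delta> \<or> w \<in> removable \<Delta>"
      using that by blast
  qed
  have "{i. t $ i \<noteq> 0} = UNIV"
    using tpos by auto
  then interpret upset UNIV "slice \<Delta> t"
    using upset_slice[of t] by simp
  have "local_order (slice \<Delta> t) \<ge> 0 \<and> (local_order (slice \<Delta> t) = 0 \<longleftrightarrow> t \<in> addable \<Delta> \<or> w \<in> removable \<Delta>)"
  proof (cases "t \<in> addable \<Delta> \<or> w \<in> removable \<Delta>")
    case True
    then have "local_order (slice \<Delta> t) = 0"
    proof
      assume "t \<in> addable \<Delta>"
      then show ?thesis
        using local_order_corner[of t] tpos by (simp add: addable_iff)
    next
      assume "w \<in> removable \<Delta>"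
      then show ?thesis
        using w by (intro local_order_eq_0) (simp_all add: removable_iff)
    qed
    then show ?thesis
      using True by simp
  next
    case False
    then obtain i where i: "{i} \<notin> slice \<Delta> t"
      using N by (auto simp: addable_iff t_def)
    have "level (slice \<Delta> t) 5 \<noteq> {}"
      using False w by (simp add: removable_iff)
    then have "local_order (slice \<Delta> t) > 0"
      using card_singletons_less[OF _ i] by (intro local_order_pos) simp_all
    then show ?thesis
      using False by simp
  qed
  then show ?thesis
    using order ex by (intro exI[of _ "local_order (slice \<Delta> t) - 1"]) auto
qed

lemma order_at_proj:
  "\<exists>n \<ge> -1. has_order (psi h \<Delta>) (proj h v) n \<and>
    (n = -1 \<longleftrightarrow> (\<exists>b\<in>addable \<Delta> \<union> removable \<Delta>. proj h b = proj h v))"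
proof -
  obtain y :: box and j n where y: "v = y + vec n" "y $ j = 0"
    using obtain_fibre_bottom by blast
  have "proj h v = proj h y"
    using y by (auto simp: proj_eq_iff[OF gen sum0 y(2)])
  then show ?thesis
    using order_bottom_outside[OF y(2)] order_bottom_inside[OF y(2)] by (cases "y \<in> \<Delta>") simp_all
qed

text \<open>No lattice point lies over \<open>z\<close>, so the sum of local orders is empty; the
  pole of \<open>1 / u\<close> lies over the origin.\<close>

lemma not_pole_off_lattice:
  assumes "z \<notin> range (proj h)"
  shows "\<not> is_pole (psi h \<Delta>) z"
proof -
  have "proj h 0 = 0"
    by (simp add: proj_def)
  then have "z \<noteq> 0"
    using assms by (metis rangeI)
  have empty: "{v. slice \<Delta> v \<noteq> {} \<and> proj h v = z} = {}"
    using assms by auto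
  have "finite \<Delta>"
    using part by (simp add: is_partition_def)
  from psi_order[OF sum0 this, of z] have "has_order (psi h \<Delta>) z 0"
    using \<open>z \<noteq> 0\<close> unfolding empty by simp
  then show ?thesis
    by (simp add: has_order_is_pole)
qed

end
end

section \<open>Poles of the rational function\<close>

theorem mainTheorem1:
  fixes h :: "complex ^ 6" and \<Delta> :: "box set"
  assumes "generic h" and "(\<Sum>i\<in>UNIV. h $ i) = 0" and "is_partition \<Delta>"
  shows "(\<forall>z. is_pole (psi h \<Delta>) z \<longrightarrow> has_simple_pole (psi h \<Delta>) z)
    \<and> (\<forall>b :: box. has_simple_pole (psi h \<Delta>) (proj h b) \<longleftrightarrow>
          (\<exists>b' \<in> addable \<Delta> \<union> removable \<Delta>. proj h b' = proj h b))
    \<and> {z. is_pole (psi h \<Delta>) z} = proj h ` (addable \<Delta> \<union> removable \<Delta>)"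
proof -
  let ?R = "\<lambda>v. \<exists>b' \<in> addable \<Delta> \<union> removable \<Delta>. proj h b' = proj h v"
  have pole: "is_pole (psi h \<Delta>) (proj h v) \<longleftrightarrow> ?R v"
    "has_simple_pole (psi h \<Delta>) (proj h v) \<longleftrightarrow> ?R v" for v
  proof -
    obtain n where n: "n \<ge> -1" "has_order (psi h \<Delta>) (proj h v) n" "n = -1 \<longleftrightarrow> ?R v"
      using order_at_proj[OF assms(3,1,2), of v] by blast
    then show "is_pole (psi h \<Delta>) (proj h v) \<longleftrightarrow> ?R v"
      "has_simple_pole (psi h \<Delta>) (proj h v) \<longleftrightarrow> ?R v"
      using has_order_is_pole[OF n(2)] has_order_zorder[OF n(2)] by (auto simp: has_simple_pole_def)
  qed
  have range: "\<exists>v. z = proj h v" if "is_pole (psi h \<Delta>) z" for z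
    using that not_pole_off_lattice[OF assms(3,1,2), of z] by blast
  show ?thesis
  proof (intro conjI allI impI)
    fix z assume "is_pole (psi h \<Delta>) z"
    then show "has_simple_pole (psi h \<Delta>) z"
      using range pole by metis
  next
    show "{z. is_pole (psi h \<Delta>) z} = proj h ` (addable \<Delta> \<union> removable \<Delta>)"
      using range pole(1) by (auto 4 4 simp: image_iff) metis+
  qed (rule pole(2))
qed

end
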